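(* Let $f:\mathbb{R}\to\mathbb{C}$ be such that $f\in L^1(-T,T)$ for all $T>0$, and suppose that there are constants $B\in\mathbb{R}$ and $T_1\ge 0$ such that $$\frac1T\int_{|t|<T}|t f(t)|\,dt\le B\quad\text{for all } T>T_1.$$ Let $x\in\mathbb{R}$ be a point at which the finite limit $$\lim_{T\to\infty}I_T(x)=\lim_{T\to\infty}\int_{|t|<T}f(t)e^{itx}\,dt=\ell\in\mathbb{C}$$ exists. Then at this $x$, $$\lim_{h\downarrow 0}\left\{\frac{\Delta\mathcal{L}(x;h)}{2h}-I_{1/h}(x)\right\}=0.$$
   Context: For $T>0$ and $x\in\mathbb{R}$, put $I_T(x):=\int_{|t|<T}f(t)e^{itx}\,dt$. For $h>0$ and $x\in\mathbb{R}$, the quantity $\frac{\Delta\mathcal{L}(x;h)}{2h}$ is defined by $$\frac{\Delta\mathcal{L}(x;h)}{2h}:=\int_{\mathbb{R}}f(t)e^{itx}\,\frac{\sin(th)}{th}\,dt,$$ where $\frac{\sin(th)}{th}$ is read as $1$ at $t=0$; under the hypotheses of the claim this integral exists in Lebesgue's sense. (Formally, $\mathcal{L}(x)=\int_{\mathbb{R}}f(t)\frac{e^{itx}}{it}\,dt$ and $\Delta\mathcal{L}(x;h)=\mathcal{L}(x+h)-\mathcal{L}(x-h)$, but the integral defining $\mathcal{L}$ need not exist as a Lebesgue integral; only the displayed definition is used.) *)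

theory Defs
  imports "HOL-Analysis.Analysis" "HOL-Probability.Sinc_Integral"
begin

text \<open>
  The base measure is \<open>lebesgue\<close> rather than \<open>lborel\<close>, so that \<open>f\<close> is only required
  to be Lebesgue measurable.
\<close>

definition I_trunc :: "(real \<Rightarrow> complex) \<Rightarrow> real \<Rightarrow> real \<Rightarrow> complex" where
  "I_trunc f T x = (LINT t:{t. \<bar>t\<bar> < T}|lebesgue. f t * exp (\<i> * of_real (t * x)))"

definition Lquot_integrand :: "(real \<Rightarrow> complex) \<Rightarrow> real \<Rightarrow> real \<Rightarrow> real \<Rightarrow> complex" where
  "Lquot_integrand f x h t = f t * exp (\<i> * of_real (t * x)) * of_real (sinc (t * h))"

text \<open>
  The symmetric quotient \<open>(L(x + h) - L(x - h)) / (2 h)\<close> of the formal integral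
  \<open>L(x) = \<integral> f(t) e\<^sup>i\<^sup>t\<^sup>x / (i t) dt\<close>. Since \<open>L\<close> itself need not exist as a Lebesgue
  integral, the quotient is defined directly; \<open>sinc\<close> takes the value 1 at 0.
\<close>

definition Lquot :: "(real \<Rightarrow> complex) \<Rightarrow> real \<Rightarrow> real \<Rightarrow> complex" where
  "Lquot f x h = (LINT t|lebesgue. Lquot_integrand f x h t)"

end

theory Submission
  imports Defs "HOL-Real_Asymp.Real_Asymp"
begin

text \<open>
  Put \<open>h = 1 / T\<close> and split the integral of \<open>F(t) sinc(t / T)\<close>, where \<open>F(t) = f(t) e\<^sup>i\<^sup>t\<^sup>x\<close>,
  at \<open>\<bar>t\<bar> = K T\<close>. By the mean bound, summed over dyadic annuli, the outer part is at most \<open>4 B / K\<close>,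
  uniformly in \<open>T\<close>. Integration by parts turns the inner part into
  \<open>sinc(K) I(K T) - \<integral>\<^sub>0\<^sup>K sinc'(v) I(v T) dv\<close>, where \<open>I(u)\<close> is the integral of \<open>F\<close> over \<open>\<bar>t\<bar> < u\<close>;
  since \<open>I\<close> is bounded and tends to \<open>l\<close>, this tends to \<open>sinc(K) l - (sinc(K) - 1) l = l\<close>
  for each fixed \<open>K\<close>. Hence the quotient itself tends to \<open>l\<close>, as does \<open>I(1 / h)\<close>.
\<close>

section \<open>The derivative of sinc\<close>

text \<open>The derivative of \<open>sinc\<close>: the quotient rule for \<open>sin v / v\<close>,
  extended to the origin by its limit 0.\<close>

definition dsinc :: "real \<Rightarrow> real" where
  "dsinc v = (if v = 0 then 0 else (v * cos v - sin v) / v\<^sup>2)"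

text \<open>At the origin \<open>sin h / h - 1\<close> is of order \<open>h^2\<close>, so the
  difference quotient tends to 0. Elsewhere \<open>sinc\<close> agrees with \<open>sin v / v\<close>
  on the open set \<open>-{0}\<close>.\<close>

lemma DERIV_sinc: "(sinc has_real_derivative dsinc v) (at v)"
proof (cases "v = 0")
  case True
  have "((\<lambda>h. (sin h / h - 1) / h) \<longlongrightarrow> (0::real)) (at 0)"
    by real_asymp
  then have "((\<lambda>h. (sinc (0 + h) - sinc 0) / h) \<longlongrightarrow> 0) (at 0)"
    by (rule Lim_transform_eventually) (auto simp: eventually_at_filter)
  then show ?thesis
    using True by (simp add: DERIV_def dsinc_def)
next
  case False
  have "((\<lambda>v. sin v / v) has_real_derivative dsinc v) (at v)"
    using False by (auto intro!: derivative_eq_intros simp: dsinc_def field_simps power2_eq_square)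
  then show ?thesis
    by (rule has_field_derivative_transform_within_open[where S = "-{0}"]) (use False in auto)
qed

text \<open>Near the origin \<open>v * cos v - sin v\<close> is of order \<open>v^3\<close>, so the
  quotient tends to 0. Continuity gives the fundamental theorem of calculus for \<open>sinc\<close>
  and a bound for \<open>dsinc\<close> on compact intervals.\<close>

lemma continuous_on_dsinc: "continuous_on S dsinc"
proof -
  have "isCont dsinc v" for v
  proof (cases "v = 0")
    case True
    have "((\<lambda>v. (v * cos v - sin v) / v\<^sup>2) \<longlongrightarrow> (0::real)) (at 0)"
      by real_asymp
    then have "(dsinc \<longlongrightarrow> 0) (at 0)"
      by (rule Lim_transform_eventually) (auto simp: eventually_at_filter dsinc_def)
    then show ?thesis
      using True by (simp add: isCont_def dsinc_def)
  next
    case False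
    have "isCont (\<lambda>v. (v * cos v - sin v) / v\<^sup>2) v"
      using False by (auto intro!: continuous_intros)
    moreover have "\<forall>\<^sub>F w in nhds v. dsinc w = (w * cos w - sin w) / w\<^sup>2"
      using False by (intro eventually_nhds_in_open[of "-{0}", THEN eventually_mono]) (auto simp: dsinc_def)
    ultimately show ?thesis
      by (simp add: isCont_cong)
  qed
  then show ?thesis
    by (simp add: continuous_at_imp_continuous_on)
qed

section \<open>Integration by parts over symmetric intervals\<close>

text \<open>The intervals \<open>{-n..n}\<close> have finite measure and exhaust the line. This is
  what Fubini's theorem asks of the factor \<open>lebesgue\<close>.\<close>

lemma sigma_finite_lebesgue: "sigma_finite_measure (lebesgue :: real measure)"
proof
  show "\<exists>A::real set set. countable A \<and> A \<subseteq> sets lebesgue \<and> \<Union> A = space lebesgue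
      \<and> (\<forall>a\<in>A. emeasure lebesgue a \<noteq> \<infinity>)"
  proof (intro exI conjI)
    show "\<Union> (range (\<lambda>n::nat. {-real n..real n})) = space lebesgue"
    proof (intro equalityI subsetI)
      fix t :: real
      obtain n :: nat where "\<bar>t\<bar> \<le> real n"
        using real_arch_simple by blast
      then show "t \<in> \<Union> (range (\<lambda>n::nat. {-real n..real n}))"
        by (intro UN_I[of n]) auto
    qed simp
  qed (auto simp: emeasure_completion)
qed

text \<open>
  Fubini's theorem applied to \<open>s(\<bar>t\<bar> / T) = s(K) - \<integral> D(v) dv\<close>, the integral being over \<open>\<bar>t\<bar> / T < v \<le> K\<close>;
  thus \<open>G\<close> need not be differentiable.
\<close>

lemma integral_by_parts_symmetric:
  fixes F :: "real \<Rightarrow> complex" and s D :: "real \<Rightarrow> real"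
  assumes F: "set_integrable lebesgue {t. \<bar>t\<bar> < K * T} F"
    and deriv: "\<And>v. (s has_real_derivative D v) (at v)"
    and cont: "continuous_on UNIV D"
    and K: "K > 0" and T: "T > 0"
  defines "G \<equiv> \<lambda>u. LINT t:{t. \<bar>t\<bar> < u}|lebesgue. F t"
  shows "set_integrable lborel {0..K} (\<lambda>v. D v *\<^sub>R G (v * T))"
    and "(LINT t:{t. \<bar>t\<bar> < K * T}|lebesgue. s (\<bar>t\<bar> / T) *\<^sub>R F t)
         = s K *\<^sub>R G (K * T) - (LINT v:{0..K}|lborel. D v *\<^sub>R G (v * T))"
proof -
  interpret L: sigma_finite_measure "lebesgue :: real measure"
    by (rule sigma_finite_lebesgue)
  interpret P: pair_sigma_finite "lebesgue :: real measure" "lborel :: real measure" ..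
  define E where "E = (\<lambda>t. indicator {t. \<bar>t\<bar> < K * T} t *\<^sub>R F t)"
  have E: "integrable lebesgue E"
    using F by (simp add: E_def set_integrable_def)
  have [measurable]: "E \<in> borel_measurable lebesgue"
    using E by auto
  have [measurable]: "D \<in> borel_measurable borel"
    using cont by (rule borel_measurable_continuous_onI)
  \<comment> \<open>This is a slice of the kernel \<open>H\<close> below at a fixed
    \<open>t\<close>: \<open>a\<close> stands for |t| and \<open>c\<close> for \<open>E t\<close>,
    both constant in \<open>v\<close>.\<close>
  have slice_meas: "(\<lambda>v. (indicator {0..K} v * (if a < v * T then D v else 0)) *\<^sub>R c) \<in> borel_measurable lborel"
    for a and c :: complex
    by measurable
  have [measurable]: "(\<lambda>t::real. t) \<in> measurable lebesgue borel"
    by (simp add: measurable_completion)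
  \<comment> \<open>The kernel for Fubini: its integral over \<open>t\<close> is \<open>D v\<close>
    times \<open>G (v * T)\<close> for \<open>v\<close> in \<open>{0..K}\<close>, and its integral
    over \<open>v\<close> is \<open>s K - s (|t| / T)\<close> times \<open>E t\<close>.\<close>
  define H where "H = (\<lambda>t v. (indicator {0..K} v * (if \<bar>t\<bar> < v * T then D v else 0)) *\<^sub>R E t)"
  obtain C where C: "\<And>v. v \<in> {0..K} \<Longrightarrow> \<bar>D v\<bar> \<le> C"
    using compact_continuous_image[OF continuous_on_subset[OF cont], of "{0..K}"]
    by (fastforce dest!: compact_imp_bounded simp: bounded_iff)
  have C0: "0 \<le> C"
    using C[of 0] K by auto
  have Hmeas [measurable]: "case_prod H \<in> borel_measurable (lebesgue \<Otimes>\<^sub>M lborel)"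
    unfolding H_def by measurable
  \<comment> \<open>The majorant is a product of an integrable function of \<open>t\<close> and the
    indicator of a bounded interval in \<open>v\<close>, hence integrable on the product
    space.\<close>
  have Hbound: "norm (H t v) \<le> (C * norm (E t)) * indicator {0..K} v" for t v
    using C[of v] C0 by (auto simp: H_def indicator_def intro!: mult_right_mono)
  have int_bound: "integrable lborel (\<lambda>v. (C * norm (E t)) * indicator {0..K} v)" for t
    using K by (intro integrable_mult_right integrable_real_indicator) auto
  have Hv: "integrable lborel (H t)" for t
  proof (rule Bochner_Integration.integrable_bound[OF int_bound[of t]])
    show "H t \<in> borel_measurable lborel"
      unfolding H_def by (rule slice_meas)
    have "norm (H t v) \<le> norm ((C * norm (E t)) * indicator {0..K} v)" for v
      using order_trans[OF Hbound abs_ge_self] by simp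
    then show "AE v in lborel. norm (H t v) \<le> norm ((C * norm (E t)) * indicator {0..K} v)"
      by simp
  qed
  have Hint: "integrable (lebesgue \<Otimes>\<^sub>M lborel) (case_prod H)"
  proof (rule P.Fubini_integrable)
    show "integrable lebesgue (\<lambda>t. LINT v|lborel. norm (case_prod H (t, v)))"
    proof (rule Bochner_Integration.integrable_bound)
      show "integrable lebesgue (\<lambda>t. (C * norm (E t)) * K)"
        using E by simp
      show "(\<lambda>t. LINT v|lborel. norm (case_prod H (t, v))) \<in> borel_measurable lebesgue"
        by measurable
      have "norm (LINT v|lborel. norm (H t v)) \<le> norm (C * norm (E t) * K)" for t
      proof -
        have "(LINT v|lborel. norm (H t v)) \<le> (LINT v|lborel. (C * norm (E t)) * indicator {0..K} v)"
          by (intro integral_mono integrable_norm Hv int_bound Hbound)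
        also have "\<dots> = C * norm (E t) * K"
          using K by simp
        finally show ?thesis
          using C0 K by simp
      qed
      then show "AE t in lebesgue. norm (LINT v|lborel. norm (case_prod H (t, v))) \<le> norm (C * norm (E t) * K)"
        by simp
    qed
  qed (use Hv in auto)
  have slice: "(LINT t|lebesgue. H t v) = indicator {0..K} v *\<^sub>R (D v *\<^sub>R G (v * T))" for v
  proof (cases "v \<in> {0..K}")
    case True
    \<comment> \<open>For \<open>v \<le> K\<close> the set where |t| < \<open>v * T\<close> lies
      inside the one that cuts off \<open>E\<close>, so \<open>E\<close> may be replaced by
      \<open>F\<close>.\<close>
    have "H t v = D v *\<^sub>R (indicator {t. \<bar>t\<bar> < v * T} t *\<^sub>R F t)" for t
    proof -
      have "v * T \<le> K * T"
        using True T by simp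
      then show ?thesis
        using True by (auto simp: H_def E_def indicator_def)
    qed
    then show ?thesis
      using True by (simp add: G_def set_lebesgue_integral_def del: scaleR_scaleR)
  qed (simp add: H_def)
  show "set_integrable lborel {0..K} (\<lambda>v. D v *\<^sub>R G (v * T))"
    using P.integrable_snd[OF Hint] by (simp add: slice set_integrable_def)
  \<comment> \<open>This is the fundamental theorem of calculus on the interval from |t| /
    \<open>T\<close> to \<open>K\<close>. For |t| \<ge> \<open>K * T\<close> both sides vanish with
    \<open>E t\<close>.\<close>
  have inner: "(LINT v|lborel. H t v) = s K *\<^sub>R E t - s (\<bar>t\<bar> / T) *\<^sub>R E t" for t
  proof (cases "\<bar>t\<bar> < K * T")
    case True
    define a where "a = \<bar>t\<bar> / T"
    have a: "0 \<le> a" "a \<le> K"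
      using True T by (auto simp: a_def field_simps)
    have "(LBINT v=a..K. D v) = s K - s a"
      by (rule interval_integral_FTC_finite)
         (auto intro: continuous_on_subset[OF cont] has_field_derivative_at_within deriv
           simp flip: has_real_derivative_iff_has_vector_derivative)
    then have FTC: "(LINT v|lborel. indicator {a<..K} v * D v) = s K - s a"
      using a by (simp add: interval_integral_Ioc set_lebesgue_integral_def)
    have "H t v = (indicator {a<..K} v * D v) *\<^sub>R E t" for v
    proof -
      have "\<bar>t\<bar> < v * T \<longleftrightarrow> a < v"
        using T by (simp add: a_def field_simps)
      then show ?thesis
        using a by (auto simp: H_def indicator_def)
    qed
    moreover have "set_integrable lborel {a..K} D"
      unfolding set_integrable_def
      by (rule borel_integrable_compact[OF compact_Icc continuous_on_subset[OF cont]]) simp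
    then have "set_integrable lborel {a<..K} D"
      by (rule set_integrable_subset) auto
    ultimately have "(LINT v|lborel. H t v) = (LINT v|lborel. indicator {a<..K} v * D v) *\<^sub>R E t"
      by (simp add: set_integrable_def)
    also have "\<dots> = s K *\<^sub>R E t - s a *\<^sub>R E t"
      by (simp add: FTC scaleR_diff_left)
    finally show ?thesis
      by (simp add: a_def)
  qed (simp add: H_def E_def)
  have "(LINT v:{0..K}|lborel. D v *\<^sub>R G (v * T)) = (LINT v|lborel. LINT t|lebesgue. H t v)"
    by (simp add: slice set_lebesgue_integral_def)
  also have "\<dots> = (LINT t|lebesgue. LINT v|lborel. H t v)"
    by (rule P.Fubini_integral[OF Hint])
  also have "\<dots> = (LINT t|lebesgue. s K *\<^sub>R E t - s (\<bar>t\<bar> / T) *\<^sub>R E t)"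
    by (simp add: inner)
  also have "\<dots> = s K *\<^sub>R (LINT t|lebesgue. E t) - (LINT t|lebesgue. s (\<bar>t\<bar> / T) *\<^sub>R E t)"
  proof (subst Bochner_Integration.integral_diff)
    \<comment> \<open>By \<open>inner\<close>, the weighted function is the difference of two
      integrable ones, the second supplied by Fubini.\<close>
    have "integrable lebesgue (\<lambda>t. s K *\<^sub>R E t - (LINT v|lborel. H t v))"
      using E P.integrable_fst[OF Hint] by simp
    then show "integrable lebesgue (\<lambda>t. s (\<bar>t\<bar> / T) *\<^sub>R E t)"
      by (simp add: inner)
  qed (use E in auto)
  finally show "(LINT t:{t. \<bar>t\<bar> < K * T}|lebesgue. s (\<bar>t\<bar> / T) *\<^sub>R F t)
         = s K *\<^sub>R G (K * T) - (LINT v:{0..K}|lborel. D v *\<^sub>R G (v * T))"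
    by (simp add: G_def E_def set_lebesgue_integral_def mult_ac)
qed

section \<open>The tail estimate from the mean bound\<close>

text \<open>The function is the pointwise limit of its truncations to bounded intervals;
  \<open>Suc n\<close> keeps every radius positive.\<close>

lemma borel_measurable_if_locally_integrable:
  fixes f :: "real \<Rightarrow> 'a::{banach, second_countable_topology}"
  assumes "\<And>T. T > 0 \<Longrightarrow> set_integrable lebesgue {-T<..<T} f"
  shows "f \<in> borel_measurable lebesgue"
proof (rule borel_measurable_LIMSEQ_metric)
  show "(\<lambda>t. indicator {-real (Suc n)<..<real (Suc n)} t *\<^sub>R f t) \<in> borel_measurable lebesgue" for n
    using assms[of "real (Suc n)"] by (auto simp: set_integrable_def)
  fix t :: real
  obtain N :: nat where N: "\<bar>t\<bar> \<le> real N"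
    using real_arch_simple by blast
  have "\<forall>\<^sub>F n in sequentially. indicator {-real (Suc n)<..<real (Suc n)} t *\<^sub>R f t = f t"
    using eventually_ge_at_top[of N] by eventually_elim (use N in \<open>auto simp: indicator_def\<close>)
  then show "(\<lambda>n. indicator {-real (Suc n)<..<real (Suc n)} t *\<^sub>R f t) \<longlonglongrightarrow> f t"
    by (rule tendsto_eventually)
qed

text \<open>Where \<open>R\<close> \<le> |t| < \<open>2 * R\<close>, one has 1 / |t| \<le> |t| /
  \<open>R^2\<close>, so the mean bound at radius \<open>2 * R\<close> bounds the integral over this
  annulus by \<open>2 * B / R\<close>. Taking \<open>R = 2 ^ n * A\<close> and summing the geometric
  series gives \<open>4 * B / A\<close>.\<close>

lemma tail_bound_of_mean_bound:
  fixes f :: "real \<Rightarrow> complex"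
  assumes f_L1: "\<And>T. T > 0 \<Longrightarrow> set_integrable lebesgue {-T<..<T} f"
    and mean_bound: "\<And>T. T > T\<^sub>1 \<Longrightarrow>
      1 / T * (LINT t:{t. \<bar>t\<bar> < T}|lebesgue. cmod (of_real t * f t)) \<le> B"
    and A: "A > T\<^sub>1" "A > 0"
  shows "set_integrable lebesgue {t. A \<le> \<bar>t\<bar>} (\<lambda>t. cmod (f t) / \<bar>t\<bar>)" (is ?integrable)
    and "(LINT t:{t. A \<le> \<bar>t\<bar>}|lebesgue. cmod (f t) / \<bar>t\<bar>) \<le> 4 * B / A" (is ?bound)
proof -
  define W where "W = (\<lambda>t. cmod (f t) / \<bar>t\<bar>)"
  have [measurable]: "f \<in> borel_measurable lebesgue"
    using f_L1 by (rule borel_measurable_if_locally_integrable)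
  have [measurable]: "(\<lambda>t::real. t) \<in> measurable lebesgue borel"
    by (simp add: measurable_completion)
  have [measurable]: "W \<in> borel_measurable lebesgue"
    unfolding W_def by measurable
  have ball_eq: "{t. \<bar>t\<bar> < R} = {-R<..<R}" for R :: real
    by auto
  \<comment> \<open>The mean bound says nothing about integrability, as the integral of a
    non-integrable function is 0 by convention. Local integrability of \<open>f\<close> supplies
    it.\<close>
  have first_moment: "set_integrable lebesgue {t. \<bar>t\<bar> < R} (\<lambda>t. cmod (of_real t * f t))" if "R > 0" for R
  proof (rule set_integrable_bound)
    show "set_integrable lebesgue {t. \<bar>t\<bar> < R} (\<lambda>t. R *\<^sub>R f t)"
      using f_L1[OF that] by (simp add: ball_eq)
    show "set_borel_measurable lebesgue {t. \<bar>t\<bar> < R} (\<lambda>t. cmod (of_real t * f t))"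
      unfolding set_borel_measurable_def by measurable
    show "AE t in lebesgue. t \<in> {t. \<bar>t\<bar> < R} \<longrightarrow> norm (cmod (of_real t * f t)) \<le> norm (R *\<^sub>R f t)"
      by (auto simp: norm_mult intro!: mult_right_mono)
  qed
  have B0: "B \<ge> 0"
  proof -
    have "0 \<le> 1 / A * (LINT t:{t. \<bar>t\<bar> < A}|lebesgue. cmod (of_real t * f t))"
      using A by (intro mult_nonneg_nonneg) (auto simp: set_lebesgue_integral_def intro!: integral_nonneg)
    then show ?thesis
      using mean_bound[of A] A by linarith
  qed
  have annulus: "set_integrable lebesgue {t. R \<le> \<bar>t\<bar> \<and> \<bar>t\<bar> < 2 * R} W"
      "(LINT t:{t. R \<le> \<bar>t\<bar> \<and> \<bar>t\<bar> < 2 * R}|lebesgue. W t) \<le> 2 * B / R" if R: "R > T\<^sub>1" "R > 0" for R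
  proof -
    let ?V = "\<lambda>t. (1 / R\<^sup>2) * (indicator {t. \<bar>t\<bar> < 2 * R} t *\<^sub>R cmod (of_real t * f t))"
    have V: "integrable lebesgue ?V"
      using first_moment[of "2 * R"] R unfolding set_integrable_def by (intro integrable_mult_right) auto
    have le: "indicator {t. R \<le> \<bar>t\<bar> \<and> \<bar>t\<bar> < 2 * R} t *\<^sub>R W t \<le> ?V t" for t
    proof (cases "R \<le> \<bar>t\<bar> \<and> \<bar>t\<bar> < 2 * R")
      case True
      then have "R\<^sup>2 \<le> \<bar>t\<bar>\<^sup>2"
        using R by (intro power_mono) auto
      moreover have "\<bar>t\<bar> > 0"
        using True R by linarith
      ultimately have "1 / \<bar>t\<bar> \<le> \<bar>t\<bar> / R\<^sup>2"
        using R by (simp add: field_simps power2_eq_square)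
      then have "1 / \<bar>t\<bar> * cmod (f t) \<le> \<bar>t\<bar> / R\<^sup>2 * cmod (f t)"
        by (rule mult_right_mono) simp
      then show ?thesis
        using True by (simp add: W_def norm_mult)
    qed auto
    have nonneg: "0 \<le> indicator {t. R \<le> \<bar>t\<bar> \<and> \<bar>t\<bar> < 2 * R} t *\<^sub>R W t" for t
      by (simp add: W_def)
    show int: "set_integrable lebesgue {t. R \<le> \<bar>t\<bar> \<and> \<bar>t\<bar> < 2 * R} W"
      unfolding set_integrable_def
    proof (rule Bochner_Integration.integrable_bound[OF V])
      show "AE t in lebesgue. norm (indicator {t. R \<le> \<bar>t\<bar> \<and> \<bar>t\<bar> < 2 * R} t *\<^sub>R W t) \<le> norm (?V t)"
        by (intro AE_I2) (use order_trans[OF nonneg le] le nonneg in \<open>simp only: real_norm_def abs_of_nonneg\<close>)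
    qed measurable
    have "(LINT t:{t. R \<le> \<bar>t\<bar> \<and> \<bar>t\<bar> < 2 * R}|lebesgue. W t) \<le> integral\<^sup>L lebesgue ?V"
      using int V le unfolding set_integrable_def set_lebesgue_integral_def by (rule integral_mono)
    \<comment> \<open>The factor \<open>1 / R^2\<close> is split so that the mean over radius
      \<open>2 * R\<close> appears.\<close>
    also have "\<dots> = 2 / R * (1 / (2 * R) * (LINT t:{t. \<bar>t\<bar> < 2 * R}|lebesgue. cmod (of_real t * f t)))"
      using R by (simp add: set_lebesgue_integral_def power2_eq_square)
    also have "\<dots> \<le> 2 / R * B"
      using R by (intro mult_left_mono mean_bound) auto
    finally show "(LINT t:{t. R \<le> \<bar>t\<bar> \<and> \<bar>t\<bar> < 2 * R}|lebesgue. W t) \<le> 2 * B / R"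
      by simp
  qed
  define S where "S = (\<lambda>n::nat. {t. A \<le> \<bar>t\<bar> \<and> \<bar>t\<bar> < 2 ^ n * A})"
  \<comment> \<open>The bound is the partial sum of \<open>2 * B / (2 ^ k * A)\<close> over
    \<open>k < n\<close>.\<close>
  have partial: "set_integrable lebesgue (S n) W \<and> (LINT t:S n|lebesgue. W t) \<le> 4 * B / A * (1 - 1 / 2 ^ n)" for n
  proof (induction n)
    case 0
    have "S 0 = {}"
      by (auto simp: S_def)
    then show ?case
      by (simp add: set_integrable_def set_lebesgue_integral_def)
  next
    case (Suc n)
    let ?R = "{t. 2 ^ n * A \<le> \<bar>t\<bar> \<and> \<bar>t\<bar> < 2 * (2 ^ n * A)}"
    have ge: "A \<le> 2 ^ n * A"
      using A by simp
    then have R: "2 ^ n * A > T\<^sub>1" "2 ^ n * A > 0"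
      using A by linarith+
    have S: "S (Suc n) = S n \<union> ?R"
      using order_trans[OF ge] by (auto simp: S_def)
    have disj: "S n \<inter> ?R = {}"
      by (auto simp: S_def)
    have "set_integrable lebesgue (S (Suc n)) W"
      unfolding S by (rule set_integrable_Un) (use Suc annulus(1)[OF R] in \<open>auto simp: S_def\<close>)
    moreover have "(LINT t:S (Suc n)|lebesgue. W t) = (LINT t:S n|lebesgue. W t) + (LINT t:?R|lebesgue. W t)"
      unfolding S by (rule set_integral_Un) (use Suc annulus(1)[OF R] disj in auto)
    moreover have "4 * B / A * (1 - 1 / 2 ^ n) + 2 * B / (2 ^ n * A) = 4 * B / A * (1 - 1 / 2 ^ Suc n)"
      using A by (simp add: field_simps)
    ultimately show ?case
      using Suc annulus(2)[OF R] by linarith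
  qed
  let ?X = "\<lambda>n. LINT t:S n|lebesgue. W t"
  have S_mono: "S m \<subseteq> S n" if "m \<le> n" for m n
  proof -
    have "2 ^ m * A \<le> 2 ^ n * A"
      using that A by (simp add: power_increasing)
    then show ?thesis
      by (auto simp: S_def)
  qed
  have pointwise_mono: "mono (\<lambda>n. indicator (S n) t *\<^sub>R W t)" for t
    using S_mono by (fastforce simp: mono_def indicator_def W_def)
  have X_le: "?X n \<le> 4 * B / A" for n
  proof -
    have "4 * B / A * (1 - 1 / 2 ^ n) \<le> 4 * B / A"
      using A B0 by (intro mult_right_le_one_le) auto
    then show ?thesis
      using partial[of n] by linarith
  qed
  \<comment> \<open>Increasing and bounded by \<open>4 * B / A\<close>, the partial integrals
    converge; monotone convergence then yields both the integrability and the value of the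
    tail.\<close>
  have "incseq ?X"
    using partial pointwise_mono unfolding incseq_def set_integrable_def set_lebesgue_integral_def
    by (auto intro!: integral_mono dest: monoD)
  then obtain L where L: "?X \<longlonglongrightarrow> L"
    using X_le incseq_convergent by metis
  have pointwise_lim: "(\<lambda>n. indicator (S n) t *\<^sub>R W t) \<longlonglongrightarrow> indicator {t. A \<le> \<bar>t\<bar>} t *\<^sub>R W t" for t
  proof -
    obtain N where "\<bar>t\<bar> / A < 2 ^ N"
      using real_arch_pow[of 2 "\<bar>t\<bar> / A"] by auto
    then have "\<bar>t\<bar> < 2 ^ N * A"
      using A by (simp add: field_simps)
    then have "t \<in> S N \<longleftrightarrow> A \<le> \<bar>t\<bar>"
      by (simp add: S_def)
    then have "t \<in> S n \<longleftrightarrow> A \<le> \<bar>t\<bar>" if "N \<le> n" for n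
      using S_mono[OF that] by (auto simp: S_def)
    then have "\<forall>\<^sub>F n in sequentially. indicator (S n) t *\<^sub>R W t = indicator {t. A \<le> \<bar>t\<bar>} t *\<^sub>R W t"
      unfolding eventually_sequentially by (auto simp: indicator_def)
    then show ?thesis
      by (rule tendsto_eventually)
  qed
  have conv: "has_bochner_integral lebesgue (\<lambda>t. indicator {t. A \<le> \<bar>t\<bar>} t *\<^sub>R W t) L"
  proof (rule has_bochner_integral_monotone_convergence)
    show "integrable lebesgue (\<lambda>t. indicator (S n) t *\<^sub>R W t)" for n
      using partial by (simp add: set_integrable_def)
    show "AE t in lebesgue. mono (\<lambda>n. indicator (S n) t *\<^sub>R W t)"
      by (rule AE_I2, rule pointwise_mono)
    show "AE t in lebesgue. (\<lambda>n. indicator (S n) t *\<^sub>R W t) \<longlonglongrightarrow> indicator {t. A \<le> \<bar>t\<bar>} t *\<^sub>R W t"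
      by (rule AE_I2, rule pointwise_lim)
    show "(\<lambda>n. LINT t|lebesgue. indicator (S n) t *\<^sub>R W t) \<longlonglongrightarrow> L"
      using L by (simp add: set_lebesgue_integral_def)
    show "(\<lambda>t. indicator {t. A \<le> \<bar>t\<bar>} t *\<^sub>R W t) \<in> borel_measurable lebesgue"
      by measurable
  qed
  then show ?integrable
    by (simp add: has_bochner_integral_iff set_integrable_def W_def)
  have "L \<le> 4 * B / A"
    using L X_le by (intro LIMSEQ_le_const2) auto
  then show ?bound
    using conv by (simp add: has_bochner_integral_iff set_lebesgue_integral_def W_def)
qed

section \<open>The limit of the sinc-weighted truncated integrals\<close>

text \<open>\<open>F\<close> need not be integrable on the whole line, so the limit is not taken
  under the integral over \<open>t\<close>. After integration by parts only \<open>G (v * T)\<close>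
  depends on \<open>T\<close> under the integral over \<open>v\<close>; it is bounded and tends to
  \<open>l\<close> for each \<open>v > 0\<close>, so dominated convergence applies on
  \<open>{0..K}\<close>.\<close>

lemma sinc_truncated_integral_tendsto:
  fixes F :: "real \<Rightarrow> complex" and l :: complex
  assumes F: "\<And>T. T > 0 \<Longrightarrow> set_integrable lebesgue {t. \<bar>t\<bar> < T} F"
    and lim: "((\<lambda>T. LINT t:{t. \<bar>t\<bar> < T}|lebesgue. F t) \<longlongrightarrow> l) at_top"
    and K: "K > 0"
  shows "((\<lambda>T. LINT t:{t. \<bar>t\<bar> < K * T}|lebesgue. sinc (t / T) *\<^sub>R F t) \<longlongrightarrow> l) at_top"
proof -
  define G where "G = (\<lambda>u. LINT t:{t. \<bar>t\<bar> < u}|lebesgue. F t)"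
  have limG: "(G \<longlongrightarrow> l) at_top"
    using lim by (simp add: G_def)
  obtain U where U: "\<And>u. u \<ge> U \<Longrightarrow> dist (G u) l < 1"
    using tendstoD[OF limG zero_less_one] by (auto simp: eventually_at_top_linorder)
  define V where "V = max U 1"
  define M where "M = max (norm l + 1) (LINT t:{t. \<bar>t\<bar> < V}|lebesgue. norm (F t))"
  \<comment> \<open>Beyond \<open>V\<close> the value \<open>G u\<close> is within 1 of
    \<open>l\<close>; below \<open>V\<close> it is dominated by the integral of the norm of
    \<open>F\<close> over |t| < \<open>V\<close>.\<close>
  have G_le: "norm (G u) \<le> M" for u
  proof (cases "u \<ge> V")
    case True
    then have "norm (G u) \<le> norm l + 1"
      using U[of u] norm_triangle_sub[of "G u" l] by (auto simp: V_def dist_norm)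
    then show ?thesis
      by (simp add: M_def)
  next
    case False
    have V: "integrable lebesgue (\<lambda>t. indicator {t. \<bar>t\<bar> < V} t *\<^sub>R norm (F t))"
      using F[of V] unfolding V_def set_integrable_def[symmetric] by (intro set_integrable_norm) auto
    have "norm (G u) \<le> (LINT t|lebesgue. norm (indicator {t. \<bar>t\<bar> < u} t *\<^sub>R F t))"
      unfolding G_def set_lebesgue_integral_def by (rule integral_norm_bound)
    also have "\<dots> \<le> (LINT t|lebesgue. indicator {t. \<bar>t\<bar> < V} t *\<^sub>R norm (F t))"
      by (rule integral_mono_AE'[OF V]) (use False in \<open>auto simp: indicator_def\<close>)
    finally show ?thesis
      by (simp add: M_def set_lebesgue_integral_def)
  qed
  then have M0: "M \<ge> 0"
    by (meson norm_ge_zero order_trans)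
  obtain C where C: "\<And>v. v \<in> {0..K} \<Longrightarrow> \<bar>dsinc v\<bar> \<le> C"
    using compact_continuous_image[OF continuous_on_dsinc[of "{0..K}"]]
    by (fastforce dest!: compact_imp_bounded simp: bounded_iff)
  have C0: "0 \<le> C"
    using C[of 0] K by auto
  have KT: "set_integrable lebesgue {t. \<bar>t\<bar> < K * T} F" if "T > 0" for T
    using F K that by simp
  have parts: "set_integrable lborel {0..K} (\<lambda>v. dsinc v *\<^sub>R G (v * T))"
      "(LINT t:{t. \<bar>t\<bar> < K * T}|lebesgue. sinc (\<bar>t\<bar> / T) *\<^sub>R F t)
       = sinc K *\<^sub>R G (K * T) - (LINT v:{0..K}|lborel. dsinc v *\<^sub>R G (v * T))" if "T > 0" for T
    unfolding G_def
    by (rule integral_by_parts_symmetric[OF KT[OF that] DERIV_sinc continuous_on_dsinc K that])+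
  \<comment> \<open>The value 0 for \<open>T \<le> 0\<close> makes \<open>H T\<close> measurable for
    every \<open>T\<close>, as dominated convergence demands; the limit at infinity is
    unaffected.\<close>
  define H where "H = (\<lambda>T v. if T > 0 then indicator {0..K} v *\<^sub>R (dsinc v *\<^sub>R G (v * T)) else 0)"
  have "((\<lambda>T. LINT v|lborel. H T v) \<longlongrightarrow> (LINT v|lborel. indicator {0..K} v *\<^sub>R (dsinc v *\<^sub>R l))) at_top"
  proof (rule integral_dominated_convergence_at_top)
    show "H T \<in> borel_measurable lborel" for T
    proof (cases "T > 0")
      case True
      then show ?thesis
        using borel_measurable_integrable[OF parts(1)[OF True, unfolded set_integrable_def]]
        by (simp only: H_def if_True)
    qed (simp add: H_def)
    have [measurable]: "dsinc \<in> borel_measurable borel"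
      using continuous_on_dsinc by (rule borel_measurable_continuous_onI)
    show "(\<lambda>v. indicator {0..K} v *\<^sub>R (dsinc v *\<^sub>R l)) \<in> borel_measurable lborel"
      by measurable
    show "integrable lborel (\<lambda>v. (C * M) * indicator {0..K} v)"
      using K by (intro integrable_mult_right integrable_real_indicator) auto
    have "norm (H T v) \<le> (C * M) * indicator {0..K} v" for T v
      using C[of v] G_le C0 M0 by (auto simp: H_def indicator_def intro!: mult_mono)
    then show "\<forall>\<^sub>F T in at_top. AE v in lborel. norm (H T v) \<le> (C * M) * indicator {0..K} v"
      by simp
    show "AE v in lborel. ((\<lambda>T. H T v) \<longlongrightarrow> indicator {0..K} v *\<^sub>R (dsinc v *\<^sub>R l)) at_top"
      \<comment> \<open>The null set \<open>v = 0\<close> is discarded, since \<open>v * T\<close>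
        does not tend to infinity there.\<close>
      using AE_lborel_singleton[of 0]
    proof eventually_elim
      fix v :: real
      assume "v \<noteq> 0"
      have "((\<lambda>T. indicator {0..K} v *\<^sub>R (dsinc v *\<^sub>R G (v * T))) \<longlongrightarrow> indicator {0..K} v *\<^sub>R (dsinc v *\<^sub>R l)) at_top"
      proof (cases "v \<in> {0..K}")
        case True
        then have "filterlim (\<lambda>T. v * T) at_top at_top"
          using \<open>v \<noteq> 0\<close> by (intro filterlim_tendsto_pos_mult_at_top[OF tendsto_const _ filterlim_ident]) auto
        then show ?thesis
          by (intro tendsto_intros filterlim_compose[OF limG])
      qed simp
      then show "((\<lambda>T. H T v) \<longlongrightarrow> indicator {0..K} v *\<^sub>R (dsinc v *\<^sub>R l)) at_top"
        by (rule Lim_transform_eventually)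
           (use eventually_gt_at_top[of 0] in eventually_elim, simp add: H_def)
    qed
  qed
  moreover have "(LINT v|lborel. indicator {0..K} v *\<^sub>R (dsinc v *\<^sub>R l)) = (sinc K - 1) *\<^sub>R l"
  proof -
    have "(LBINT v=0..K. dsinc v) = sinc K - sinc 0"
      unfolding zero_ereal_def
      by (rule interval_integral_FTC_finite)
         (auto intro: continuous_on_dsinc has_field_derivative_at_within DERIV_sinc
           simp flip: has_real_derivative_iff_has_vector_derivative)
    then have "(LINT v|lborel. indicator {0..K} v * dsinc v) = sinc K - 1"
      using K by (simp add: interval_integral_Icc zero_ereal_def set_lebesgue_integral_def)
    moreover have "integrable lborel (\<lambda>v. indicator {0..K} v * dsinc v)"
      using borel_integrable_compact[OF compact_Icc continuous_on_dsinc[of "{0..K}"]] by simp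
    then have "(LINT v|lborel. indicator {0..K} v *\<^sub>R (dsinc v *\<^sub>R l))
        = (LINT v|lborel. indicator {0..K} v * dsinc v) *\<^sub>R l"
      by (simp flip: integral_scaleR_left)
    ultimately show ?thesis
      by simp
  qed
  moreover have "((\<lambda>T. G (K * T)) \<longlongrightarrow> l) at_top"
    by (intro filterlim_compose[OF limG] filterlim_tendsto_pos_mult_at_top[OF tendsto_const K filterlim_ident])
  ultimately have "((\<lambda>T. sinc K *\<^sub>R G (K * T) - (LINT v|lborel. H T v)) \<longlongrightarrow> sinc K *\<^sub>R l - (sinc K - 1) *\<^sub>R l) at_top"
    by (intro tendsto_intros) auto
  then have "((\<lambda>T. sinc K *\<^sub>R G (K * T) - (LINT v|lborel. H T v)) \<longlongrightarrow> l) at_top"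
    by (simp flip: scaleR_diff_left)
  then show ?thesis
  proof (rule Lim_transform_eventually)
    show "\<forall>\<^sub>F T in at_top. sinc K *\<^sub>R G (K * T) - (LINT v|lborel. H T v)
        = (LINT t:{t. \<bar>t\<bar> < K * T}|lebesgue. sinc (t / T) *\<^sub>R F t)"
      using eventually_gt_at_top[of 0]
    proof eventually_elim
      fix T :: real
      assume T: "T > 0"
      have "sinc (\<bar>t\<bar> / T) = sinc (t / T)" for t
        by (cases "t \<ge> 0") auto
      then show "sinc K *\<^sub>R G (K * T) - (LINT v|lborel. H T v)
          = (LINT t:{t. \<bar>t\<bar> < K * T}|lebesgue. sinc (t / T) *\<^sub>R F t)"
        using parts(2)[of T] T by (simp only: H_def set_lebesgue_integral_def if_True)
    qed
  qed
qed

section \<open>Convergence of the symmetric quotient\<close>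

theorem mainTheorem2:
  fixes f :: "real \<Rightarrow> complex" and B T\<^sub>1 x :: real and l :: complex
  assumes f_L1: "\<And>T. T > 0 \<Longrightarrow> set_integrable lebesgue {-T<..<T} f"
    and T1_nonneg: "T\<^sub>1 \<ge> 0"
    and mean_bound: "\<And>T. T > T\<^sub>1 \<Longrightarrow>
      1 / T * (LINT t:{t. \<bar>t\<bar> < T}|lebesgue. cmod (of_real t * f t)) \<le> B"
    and lim_I: "((\<lambda>T. I_trunc f T x) \<longlongrightarrow> l) at_top"
  shows "(\<forall>h>0. integrable lebesgue (Lquot_integrand f x h)) \<and>
    ((\<lambda>h. Lquot f x h - I_trunc f (1 / h) x) \<longlongrightarrow> 0) (at_right 0)"
proof -
  define F where "F = (\<lambda>t. f t * exp (\<i> * of_real (t * x)))"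
  have norm_F: "norm (F t) = norm (f t)" for t
    using norm_exp_i_times[of "t * x"] by (simp add: F_def norm_mult)
  have [measurable]: "(\<lambda>t::real. t) \<in> measurable lebesgue borel"
    by (simp add: measurable_completion)
  have [measurable]: "f \<in> borel_measurable lebesgue"
    using f_L1 by (rule borel_measurable_if_locally_integrable)
  have [measurable]: "(\<lambda>t. exp (\<i> * of_real (t * x))) \<in> borel_measurable lebesgue"
    by measurable
  have [measurable]: "F \<in> borel_measurable lebesgue"
    unfolding F_def by measurable
  have meas [measurable]: "Lquot_integrand f x h \<in> borel_measurable lebesgue" for h
    unfolding Lquot_integrand_def by measurable
  have F_int: "set_integrable lebesgue {t. \<bar>t\<bar> < T} F" if "T > 0" for T
  proof (rule set_integrable_bound)
    have "{t. \<bar>t\<bar> < T} = {-T<..<T}"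
      by auto
    then show "set_integrable lebesgue {t. \<bar>t\<bar> < T} f"
      using f_L1[OF that] by simp
    show "set_borel_measurable lebesgue {t. \<bar>t\<bar> < T} F"
      unfolding set_borel_measurable_def by measurable
  qed (simp add: norm_F)
  have tail: "set_integrable lebesgue {t. A \<le> \<bar>t\<bar>} (\<lambda>t. cmod (f t) / \<bar>t\<bar>)"
      "(LINT t:{t. A \<le> \<bar>t\<bar>}|lebesgue. cmod (f t) / \<bar>t\<bar>) \<le> 4 * B / A" if "A > T\<^sub>1" "A > 0" for A
    using tail_bound_of_mean_bound[of f T\<^sub>1 B A] f_L1 mean_bound that by blast+
  have B0: "B \<ge> 0"
  proof -
    have "0 \<le> (LINT t:{t. T\<^sub>1 + 1 \<le> \<bar>t\<bar>}|lebesgue. cmod (f t) / \<bar>t\<bar>)"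
      by (auto simp: set_lebesgue_integral_def intro!: integral_nonneg)
    also have "\<dots> \<le> 4 * B / (T\<^sub>1 + 1)"
      using T1_nonneg by (intro tail(2)) auto
    finally show ?thesis
      using T1_nonneg by (simp add: zero_le_divide_iff)
  qed
  \<comment> \<open>Near the origin the bound |\<open>sinc\<close>| \<le> 1 reduces integrability to
    that of \<open>F\<close>.\<close>
  have near: "set_integrable lebesgue {t. \<bar>t\<bar> < A} (Lquot_integrand f x h)" if "A > 0" for A h
  proof (rule set_integrable_bound[OF F_int[OF that]])
    show "set_borel_measurable lebesgue {t. \<bar>t\<bar> < A} (Lquot_integrand f x h)"
      unfolding set_borel_measurable_def by measurable
    have "\<bar>sinc v\<bar> \<le> 1" for v
      using abs_sin_x_le_abs_x[of v] by (auto simp: divide_le_eq_1)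
    then have "norm (Lquot_integrand f x h t) \<le> norm (F t)" for t
      by (simp only: Lquot_integrand_def F_def norm_mult norm_of_real mult_left_le norm_ge_zero mult_nonneg_nonneg)
    then show "AE t in lebesgue. t \<in> {t. \<bar>t\<bar> < A} \<longrightarrow> norm (Lquot_integrand f x h t) \<le> norm (F t)"
      by simp
  qed
  \<comment> \<open>Away from the origin |sin| \<le> 1 gives a decay of order 1 / |t|, which matches
    the tail estimate.\<close>
  have far_le: "norm (Lquot_integrand f x h t) \<le> 1 / h * (cmod (f t) / \<bar>t\<bar>)" if "h > 0" "t \<noteq> 0" for h t
  proof -
    have "norm (Lquot_integrand f x h t) = cmod (f t) * (\<bar>sin (t * h)\<bar> / (\<bar>t\<bar> * h))"
      using that norm_F[of t] by (simp add: Lquot_integrand_def F_def norm_mult norm_divide abs_mult flip: of_real_divide)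
    also have "\<dots> \<le> cmod (f t) * (1 / (\<bar>t\<bar> * h))"
      using that by (intro mult_left_mono divide_right_mono) auto
    finally show ?thesis
      by (simp add: field_simps)
  qed
  have far: "set_integrable lebesgue {t. A \<le> \<bar>t\<bar>} (Lquot_integrand f x h)"
      "norm (LINT t:{t. A \<le> \<bar>t\<bar>}|lebesgue. Lquot_integrand f x h t) \<le> 1 / h * (4 * B / A)"
    if A: "A > T\<^sub>1" "A > 0" and h: "h > 0" for A h
  proof -
    have W: "set_integrable lebesgue {t. A \<le> \<bar>t\<bar>} (\<lambda>t. 1 / h * (cmod (f t) / \<bar>t\<bar>))"
      using tail(1)[OF A] by (intro set_integrable_mult_right) auto
    show int: "set_integrable lebesgue {t. A \<le> \<bar>t\<bar>} (Lquot_integrand f x h)"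
    proof (rule set_integrable_bound[OF W])
      show "set_borel_measurable lebesgue {t. A \<le> \<bar>t\<bar>} (Lquot_integrand f x h)"
        unfolding set_borel_measurable_def by measurable
      show "AE t in lebesgue. t \<in> {t. A \<le> \<bar>t\<bar>} \<longrightarrow>
          norm (Lquot_integrand f x h t) \<le> norm (1 / h * (cmod (f t) / \<bar>t\<bar>))"
        using far_le[OF h] A h by auto
    qed
    have "norm (LINT t:{t. A \<le> \<bar>t\<bar>}|lebesgue. Lquot_integrand f x h t)
        \<le> (LINT t:{t. A \<le> \<bar>t\<bar>}|lebesgue. norm (Lquot_integrand f x h t))"
      by (rule set_integral_norm_bound[OF int])
    also have "\<dots> \<le> (LINT t:{t. A \<le> \<bar>t\<bar>}|lebesgue. 1 / h * (cmod (f t) / \<bar>t\<bar>))"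
      by (rule set_integral_mono[OF set_integrable_norm[OF int] W]) (use far_le[OF h] A in auto)
    also have "\<dots> = 1 / h * (LINT t:{t. A \<le> \<bar>t\<bar>}|lebesgue. cmod (f t) / \<bar>t\<bar>)"
      by (rule set_integral_mult_right)
    also have "\<dots> \<le> 1 / h * (4 * B / A)"
      using h by (intro mult_left_mono tail(2)[OF A]) auto
    finally show "norm (LINT t:{t. A \<le> \<bar>t\<bar>}|lebesgue. Lquot_integrand f x h t) \<le> 1 / h * (4 * B / A)" .
  qed
  have split_UNIV: "{t. \<bar>t\<bar> < A} \<union> {t. A \<le> \<bar>t\<bar>} = UNIV" for A :: real
    by auto
  have integrable: "integrable lebesgue (Lquot_integrand f x h)" if h: "h > 0" for h
  proof -
    \<comment> \<open>The radius \<open>T\<^sub>1 + 1\<close> is positive and exceeds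
      \<open>T\<^sub>1\<close>, so \<open>near\<close> and \<open>far\<close> both apply.\<close>
    have "set_integrable lebesgue ({t. \<bar>t\<bar> < T\<^sub>1 + 1} \<union> {t. T\<^sub>1 + 1 \<le> \<bar>t\<bar>}) (Lquot_integrand f x h)"
      using T1_nonneg h by (intro set_integrable_Un near far) auto
    then show ?thesis
      unfolding split_UNIV by (simp add: set_integrable_def)
  qed
  \<comment> \<open>With \<open>h = inverse T\<close> and cut-off \<open>K * T\<close>, the factor
    \<open>1 / h = T\<close> cancels against the cut-off, so the error is uniform in
    \<open>T\<close>.\<close>
  have Lquot_split: "norm (Lquot f x (inverse T) - (LINT t:{t. \<bar>t\<bar> < K * T}|lebesgue. sinc (t / T) *\<^sub>R F t))
      \<le> 4 * B / K" if K: "K > 0" and T: "T > 0" "K * T > T\<^sub>1" for K T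
  proof -
    let ?g = "Lquot_integrand f x (inverse T)"
    have KT: "K * T > 0"
      using K T by simp
    have "Lquot f x (inverse T) = (LINT t:{t. \<bar>t\<bar> < K * T} \<union> {t. K * T \<le> \<bar>t\<bar>}|lebesgue. ?g t)"
      unfolding split_UNIV by (simp add: Lquot_def set_lebesgue_integral_def)
    also have "\<dots> = (LINT t:{t. \<bar>t\<bar> < K * T}|lebesgue. ?g t) + (LINT t:{t. K * T \<le> \<bar>t\<bar>}|lebesgue. ?g t)"
      using KT T by (intro set_integral_Un near far) auto
    finally have "norm (Lquot f x (inverse T) - (LINT t:{t. \<bar>t\<bar> < K * T}|lebesgue. ?g t))
        = norm (LINT t:{t. K * T \<le> \<bar>t\<bar>}|lebesgue. ?g t)"
      by simp
    also have "\<dots> \<le> 1 / inverse T * (4 * B / (K * T))"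
      using T KT by (intro far) auto
    also have "\<dots> = 4 * B / K"
      using T K by (simp add: field_simps)
    also have "?g = (\<lambda>t. sinc (t / T) *\<^sub>R F t)"
      by (simp add: fun_eq_iff Lquot_integrand_def F_def scaleR_conv_of_real divide_inverse mult_ac)
    finally show ?thesis .
  qed
  have Lquot_lim: "((\<lambda>T. Lquot f x (inverse T)) \<longlongrightarrow> l) at_top"
  proof (rule tendstoI)
    fix e :: real
    assume e: "e > 0"
    \<comment> \<open>This makes \<open>4 * B / K\<close> equal to
      \<open>e * B / (2 * (B + 1))\<close>, which is below \<open>e / 2\<close>; using
      \<open>B + 1\<close> keeps \<open>K\<close> positive when \<open>B = 0\<close>.\<close>
    define K where "K = 8 * (B + 1) / e"
    have K: "K > 0"
      using e B0 by (simp add: K_def)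
    have BK: "4 * B / K < e / 2"
      using e B0 by (simp add: K_def field_simps)
    have "((\<lambda>T. LINT t:{t. \<bar>t\<bar> < K * T}|lebesgue. sinc (t / T) *\<^sub>R F t) \<longlongrightarrow> l) at_top"
      using F_int lim_I K unfolding I_trunc_def F_def[symmetric] by (intro sinc_truncated_integral_tendsto) auto
    then have "\<forall>\<^sub>F T in at_top. dist (LINT t:{t. \<bar>t\<bar> < K * T}|lebesgue. sinc (t / T) *\<^sub>R F t) l < e / 2"
      using e by (intro tendstoD) auto
    then show "\<forall>\<^sub>F T in at_top. dist (Lquot f x (inverse T)) l < e"
      using eventually_gt_at_top[of "T\<^sub>1 / K"] eventually_gt_at_top[of 0]
    proof eventually_elim
      case (elim T)
      then have "K * T > T\<^sub>1"
        using K by (simp add: field_simps)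
      have "norm (Lquot f x (inverse T) - l) < e / 2 + e / 2"
        by (rule norm_diff_triangle_less[OF le_less_trans[OF Lquot_split[OF K elim(3) \<open>K * T > T\<^sub>1\<close>] BK]])
           (use elim(1) in \<open>simp only: dist_norm\<close>)
      then show ?case
        by (simp add: dist_norm)
    qed
  qed
  \<comment> \<open>Both terms tend to \<open>l\<close>. The substitution
    \<open>h = inverse T\<close> turns the limit as \<open>h\<close> decreases to 0 into one at
    infinity.\<close>
  have "((\<lambda>T. Lquot f x (inverse T) - I_trunc f (1 / inverse T) x) \<longlongrightarrow> 0) at_top"
    using tendsto_diff[OF Lquot_lim lim_I] by (simp add: inverse_eq_divide)
  then show ?thesis
    using integrable by (simp add: filterlim_at_right_to_top)
qed

end
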